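(* Let $c$ be a profile with rank $r$ and level $\ell$. Then $$F_c(u,z)=\frac{1-(1-u)zq^r}{1-zq^r}\,F_c(u,zq^r)+uz\sum_{d\ne c}\frac{q^{\Delta(d,c)}}{1-zq^{\Delta(d,c)}}\,F_d\bigl(u,zq^{\Delta(d,c)}\bigr),$$ where the sum is over all profiles $d$ except for $c$ with rank $r$ and level $\ell$.
   Context: Let $r,\ell\ge1$. A profile of rank $r$ and level $\ell$ is a tuple $c=(c_1,\dots,c_r)$ of nonnegative integers with $c_1+\cdots+c_r=\ell$. A cylindric partition with profile $c$ is an $r$-tuple $\Lambda=(\lambda^{(1)},\dots,\lambda^{(r)})$ of integer partitions (weakly decreasing, positive parts, missing entries regarded as $0$) such that $\lambda^{(i)}_j\ge\lambda^{(i+1)}_{j+c_{i+1}}$ for $1\le i\le r-1$, $j\ge1$, and $\lambda^{(r)}_j\ge\lambda^{(1)}_{j+c_1}$ for $j\ge1$. $|\Lambda|$ is the sum of all parts, $\max(\Lambda)$ the largest part appearing ($0$ if $\Lambda$ is empty), and $\mathrm{st}(\Lambda)$ the number of distinct positive integers appearing as parts in $\Lambda$. Define $$F_c(u,z)=\sum_{\Lambda\text{ with profile }c} z^{\max(\Lambda)}u^{\mathrm{st}(\Lambda)}q^{|\Lambda|},$$ a formal power series (the variable $q$ is suppressed from the notation; $F_c(u,zq^k)$ means substituting $zq^k$ for $z$). A slice of profile $c$ is a cylindric partition of profile $c$ with all parts equal to $1$, given by its row lengths $(n_1,\dots,n_r)$; its weight is $n_1+\cdots+n_r$. Its right end is governed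 by the profile $d$ with $d_i=c_i+n_{i-1}-n_i$ for $1\le i\le r$ (with $n_0:=n_r$). For profiles $c,d$ of the same rank and level, $\Delta(d,c)$ is the smallest weight of a slice of profile $c$ whose right end is $d$, i.e. the minimum of $n_1+\cdots+n_r$ over tuples of nonnegative integers with $d_i=c_i+n_{i-1}-n_i$ for all $i$ (indices mod $r$). *)

theory Defs
  imports "HOL-Computational_Algebra.Formal_Power_Series" "HOL-Library.More_List"
begin

(* Tuples indexed by 1, ..., r are lists of length r indexed by 0, ..., r - 1, and the
   parts of a partition are indexed from 0 as well. *)

definition is_profile :: "nat \<Rightarrow> nat \<Rightarrow> nat list \<Rightarrow> bool" where
  "is_profile r l c \<longleftrightarrow> length c = r \<and> sum_list c = l"

definition is_partition :: "nat list \<Rightarrow> bool" where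
  "is_partition xs \<longleftrightarrow> sorted_wrt (\<ge>) xs \<and> 0 \<notin> set xs"

abbreviation part :: "nat list \<Rightarrow> nat \<Rightarrow> nat" where
  "part \<equiv> nth_default 0"

(* The successor index is cyclic, so the index i = r - 1 gives the wrap-around inequality
   between the last partition and the first one. *)
definition cylindric :: "nat list \<Rightarrow> nat list list \<Rightarrow> bool" where
  "cylindric c L \<longleftrightarrow> length L = length c \<and> (\<forall>xs \<in> set L. is_partition xs) \<and>
     (\<forall>i < length c. \<forall>j. let i' = Suc i mod length c in
        part (L ! i) j \<ge> part (L ! i') (j + c ! i'))"

definition parts_of :: "nat list list \<Rightarrow> nat set" where
  "parts_of L = (\<Union>xs \<in> set L. set xs)"

definition weight :: "nat list list \<Rightarrow> nat" where
  "weight L = sum_list (map sum_list L)"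

definition max_part :: "nat list list \<Rightarrow> nat" where
  "max_part L = (if parts_of L = {} then 0 else Max (parts_of L))"

definition num_sizes :: "nat list list \<Rightarrow> nat" where
  "num_sizes L = card (parts_of L)"

definition is_slice :: "nat list \<Rightarrow> nat list list \<Rightarrow> bool" where
  "is_slice c L \<longleftrightarrow> cylindric c L \<and> (\<forall>x \<in> parts_of L. x = 1)"

definition right_end :: "nat list \<Rightarrow> nat list list \<Rightarrow> nat list \<Rightarrow> bool" where
  "right_end c L d \<longleftrightarrow> length d = length c \<and>
     (\<forall>i < length c. int (d ! i) =
        int (c ! i) + int (length (L ! ((i + length c - 1) mod length c))) - int (length (L ! i)))"

definition Delta :: "nat list \<Rightarrow> nat list \<Rightarrow> nat" where
  "Delta d c = (LEAST w. \<exists>L. is_slice c L \<and> right_end c L d \<and> weight L = w)"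

(* Power series in z, u, q: the outermost series variable is z, then u, then q. *)
type_synonym series = "rat fps fps fps"

definition zvar :: series where "zvar = fps_X"
definition uvar :: series where "uvar = fps_const fps_X"
definition qvar :: series where "qvar = fps_const (fps_const fps_X)"

(* The coefficient of z^m u^s q^n in the sum over all cylindric partitions of profile c;
   lemma finite_cylindric shows that the counted sets are finite. *)
definition F :: "nat list \<Rightarrow> series" where
  "F c = Abs_fps (\<lambda>m. Abs_fps (\<lambda>s. Abs_fps (\<lambda>n.
     of_nat (card {L. cylindric c L \<and> max_part L = m \<and> num_sizes L = s \<and> weight L = n}))))"

definition F_at :: "nat list \<Rightarrow> series \<Rightarrow> series" where
  "F_at c w = fps_compose (F c) w"

lemma F_at_zvar: "F_at c zvar = F c"
  by (simp add: F_at_def zvar_def)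

lemma F_at_shift_nth: "fps_nth (F_at c (zvar * qvar ^ k)) m = fps_nth (F c) m * fps_const (fps_X ^ (k * m))"
proof -
  have q: "qvar ^ k = fps_const (fps_const (fps_X ^ k))"
    by (simp add: qvar_def fps_const_power)
  have "fps_nth (F_at c (zvar * qvar ^ k)) m
      = (\<Sum>i=0..m. fps_nth (F c) i * fps_nth ((fps_const (fps_const (fps_X ^ k)) * fps_X) ^ i) m)"
    by (simp add: F_at_def fps_compose_nth q zvar_def mult.commute)
  also have "\<dots> = (\<Sum>i=0..m. if i = m then fps_nth (F c) m * fps_const (fps_X ^ (k * m)) else 0)"
    by (intro sum.cong)
       (auto simp: power_mult_distrib fps_const_power fps_X_power_iff power_mult)
  finally show ?thesis by simp
qed

lemma div_one_minus:
  "(a / (1 - zvar * qvar ^ k)) * (1 - zvar * qvar ^ k) = (a :: series)"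
proof -
  let ?g = "1 - zvar * qvar ^ k"
  have g0: "fps_nth ?g 0 = 1" by (simp add: zvar_def)
  have "subdegree ?g = 0"
    by (rule subdegree_eq_0) (simp only: g0, simp)
  then have "a / ?g = a * inverse ?g" by (rule fps_divide_unit')
  moreover have "inverse (1 :: rat fps fps) = 1" by (intro fps_inverse_one') simp
  then have "?g * inverse ?g = 1"
    unfolding fps_inverse_def[of ?g] by (intro fps_right_inverse) (simp only: g0 mult_1_left)
  ultimately show ?thesis by (simp only: mult.assoc mult.commute[of "inverse ?g"] mult_1_right)
qed

lemma finite_profiles: "finite {d. is_profile r l d}"
proof (rule finite_subset)
  show "{d. is_profile r l d} \<subseteq> {d. set d \<subseteq> {0..l} \<and> length d = r}"
    by (auto simp: is_profile_def dest: member_le_sum_list)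
  show "finite {d. set d \<subseteq> {0..l} \<and> length d = r}"
    by (rule finite_lists_length_eq) simp
qed

lemma finite_cylindric: "finite {L. cylindric c L \<and> weight L = n}"
proof -
  let ?X = "{xs::nat list. set xs \<subseteq> {0..n} \<and> length xs \<le> n}"
  have len: "length xs \<le> sum_list xs" if "0 \<notin> set xs" for xs :: "nat list"
    using that by (induction xs) auto
  have "{L. cylindric c L \<and> weight L = n} \<subseteq> {L. set L \<subseteq> ?X \<and> length L = length c}"
  proof (clarsimp simp: cylindric_def is_partition_def weight_def subset_iff)
    fix L :: "nat list list" and xs
    assume *: "\<forall>xs\<in>set L. sorted_wrt (\<lambda>x y. y \<le> x) xs \<and> 0 \<notin> set xs" "xs \<in> set L"
    have "sum_list xs \<le> sum_list (map sum_list L)"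
      using *(2) member_le_sum_list[of "sum_list xs" "map sum_list L"] by auto
    moreover have "length xs \<le> sum_list xs" using * len by auto
    moreover have "x \<le> sum_list xs" if "x \<in> set xs" for x
      using that by (intro member_le_sum_list) auto
    ultimately show "(\<forall>t. t \<in> set xs \<longrightarrow> t \<le> sum_list (map sum_list L)) \<and>
        length xs \<le> sum_list (map sum_list L)"
      by (meson le_trans)
  qed
  moreover have "finite ?X" by (rule finite_lists_length_le) simp
  hence "finite {L. set L \<subseteq> ?X \<and> length L = length c}"
    by (rule finite_lists_length_eq)
  ultimately show ?thesis by (rule finite_subset)
qed

lemma right_end_slice:
  assumes "length d = length c" "length n = length c"
    and eq: "\<forall>i < length c. int (d ! i) =
      int (c ! i) + int (n ! ((i + length c - 1) mod length c)) - int (n ! i)"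
  defines "L \<equiv> map (\<lambda>k. replicate k (1::nat)) n"
  shows "is_slice c L \<and> right_end c L d \<and> weight L = sum_list n"
proof -
  let ?r = "length c"
  have lenL: "length (L ! i) = n ! i" if "i < ?r" for i
    using that assms(2) by (simp add: L_def)
  have prt: "part (L ! i) j = (if j < n ! i then 1 else 0)" if "i < ?r" for i j
    using that assms(2) by (simp add: L_def nth_default_def)
  have "cylindric c L"
    unfolding cylindric_def Let_def
  proof (intro conjI allI impI ballI)
    show "length L = ?r" using assms(2) by (simp add: L_def)
    show "is_partition xs" if "xs \<in> set L" for xs
      using that by (auto simp: L_def is_partition_def sorted_wrt_iff_nth_less)
    fix i j assume i: "i < ?r"
    define i' where "i' = Suc i mod ?r"
    have i': "i' < ?r" using i unfolding i'_def by (intro mod_less_divisor) linarith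
    have "(i' + ?r - 1) mod ?r = i"
    proof (cases "Suc i = ?r")
      case True
      then have "i' = 0" by (simp add: i'_def)
      with True show ?thesis by (metis add_0 diff_Suc_1 i mod_less)
    next
      case False
      then have "i' = Suc i" using i by (simp add: i'_def)
      then show ?thesis using i by simp
    qed
    with eq i' have "int (d ! i') = int (c ! i') + int (n ! i) - int (n ! i')"
      by metis
    then have "n ! i' \<le> c ! i' + n ! i" by linarith
    then show "part (L ! (Suc i mod ?r)) (j + c ! (Suc i mod ?r)) \<le> part (L ! i) j"
      unfolding i'_def[symmetric] using prt[OF i] prt[OF i'] by auto
  qed
  moreover have "\<forall>x \<in> parts_of L. x = 1"
    by (auto simp: L_def parts_of_def)
  moreover have "right_end c L d"
    unfolding right_end_def
  proof (intro conjI allI impI)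
    show "length d = ?r" by fact
    fix i assume i: "i < ?r"
    then have "(i + ?r - 1) mod ?r < ?r" by (intro mod_less_divisor) linarith
    then show "int (d ! i) =
        int (c ! i) + int (length (L ! ((i + ?r - 1) mod ?r))) - int (length (L ! i))"
      using eq i lenL by metis
  qed
  moreover have "weight L = sum_list n"
    by (simp add: weight_def L_def comp_def sum_list_replicate)
  ultimately show ?thesis by (simp add: is_slice_def)
qed

lemma weight_slice:
  assumes "is_slice c L"
  shows "weight L = sum_list (map length L)"
proof -
  have "sum_list xs = length xs" if "\<forall>x \<in> set xs. x = 1" for xs :: "nat list"
    using that by (induction xs) auto
  moreover have "\<forall>x \<in> set xs. x = 1" if "xs \<in> set L" for xs
    using assms that by (auto simp: is_slice_def parts_of_def)
  ultimately have "map sum_list L = map length L" by (intro map_cong) auto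
  then show ?thesis by (simp only: weight_def)
qed

lemma Delta_row_lengths:
  assumes "length d = length c"
  shows "Delta d c = (LEAST w. \<exists>n. length n = length c \<and>
    (\<forall>i < length c. int (d ! i) =
      int (c ! i) + int (n ! ((i + length c - 1) mod length c)) - int (n ! i)) \<and>
    sum_list n = w)" (is "_ = (LEAST w. \<exists>n. ?P n \<and> ?Q n \<and> ?R n w)")
proof -
  have "(\<exists>L. is_slice c L \<and> right_end c L d \<and> weight L = w) \<longleftrightarrow> (\<exists>n. ?P n \<and> ?Q n \<and> ?R n w)" for w
  proof
    assume "\<exists>L. is_slice c L \<and> right_end c L d \<and> weight L = w"
    then obtain L where L: "is_slice c L" "right_end c L d" "weight L = w" by blast
    have len: "length L = length c" using L(1) by (simp add: is_slice_def cylindric_def)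
    have "?P (map length L)" using len by simp
    moreover have "?Q (map length L)"
    proof (intro allI impI)
      fix i assume i: "i < length c"
      then have "(i + length c - 1) mod length c < length c"
        by (intro mod_less_divisor) linarith
      with L(2) i len show "int (d ! i) = int (c ! i) +
          int (map length L ! ((i + length c - 1) mod length c)) - int (map length L ! i)"
        by (simp add: right_end_def)
    qed
    moreover have "?R (map length L) w" using L weight_slice by auto
    ultimately show "\<exists>n. ?P n \<and> ?Q n \<and> ?R n w" by blast
  next
    assume "\<exists>n. ?P n \<and> ?Q n \<and> ?R n w"
    then show "\<exists>L. is_slice c L \<and> right_end c L d \<and> weight L = w"
      using right_end_slice[OF assms] by metis
  qed
  then show ?thesis by (simp only: Delta_def)
qed

lemma Delta_attained:
  assumes "is_profile r l c" "is_profile r l d"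
  shows "\<exists>L. is_slice c L \<and> right_end c L d \<and> weight L = Delta d c"
proof -
  have len: "length c = r" "length d = r" and sums: "sum_list c = l" "sum_list d = l"
    using assms by (auto simp: is_profile_def)
  define f where "f = (\<lambda>i. int l + (\<Sum>k<Suc i. int (c ! k) - int (d ! k)))"
  have tot: "(\<Sum>k<r. int (c ! k)) = int l" "(\<Sum>k<r. int (d ! k)) = int l"
    using len sums by (auto simp: sum_list_sum_nth atLeast0LessThan simp flip: of_nat_sum)
  have f0: "f i \<ge> 0" if "i < r" for i
  proof -
    have "(\<Sum>k<Suc i. int (d ! k)) \<le> (\<Sum>k<r. int (d ! k))"
      using that by (intro sum_mono2) auto
    moreover have "(\<Sum>k<Suc i. int (c ! k)) \<ge> 0" by (intro sum_nonneg) auto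
    ultimately show ?thesis unfolding f_def sum_subtractf using tot by linarith
  qed
  define n where "n = map (\<lambda>i. nat (f i)) [0..<r]"
  have n: "int (n ! i) = f i" if "i < r" for i using that f0 by (simp add: n_def)
  have "int (d ! i) = int (c ! i) + int (n ! ((i + r - 1) mod r)) - int (n ! i)" if i: "i < r" for i
  proof (cases i)
    case 0
    have r: "Suc (r - 1) = r" "(i + r - 1) mod r = r - 1" "r - 1 < r" using i 0 by auto
    have "f (r - 1) = int l" unfolding f_def r(1) sum_subtractf using tot by simp
    moreover have "f 0 = int l + int (c ! 0) - int (d ! 0)" by (simp add: f_def)
    ultimately show ?thesis unfolding r(2) n[OF i] n[OF r(3)] using 0 by simp
  next
    case (Suc j)
    have r: "(i + r - 1) mod r = j" "j < r" using i Suc by auto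
    have "f i = f j + int (c ! i) - int (d ! i)" unfolding f_def Suc by simp
    then show ?thesis unfolding r(1) n[OF i] n[OF r(2)] by simp
  qed
  then have "\<forall>i < length c. int (d ! i) =
      int (c ! i) + int (n ! ((i + length c - 1) mod length c)) - int (n ! i)"
    by (simp add: len)
  moreover have "length d = length c" "length n = length c" by (simp_all add: len n_def)
  ultimately have "\<exists>w L. is_slice c L \<and> right_end c L d \<and> weight L = w"
    using right_end_slice[of d c n] by blast
  then show ?thesis unfolding Delta_def by (rule LeastI_ex)
qed

end

(* Fix z^m with m > 0 and let v be the tuple of multiplicities of the part m in the rows of a
   cylindric partition with maximum m. Its cells form a slice; let d be its right end.
   If v has a zero entry, then v is the slice of minimal weight with right end d, as slices with
   the same right end differ by a constant tuple; moreover d \<noteq> c because v \<noteq> 0. Removing these cells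
   leaves an arbitrary cylindric partition of profile d with maximum < m and one size less.
   If v has no zero entry, one removes only the first column, which leaves an arbitrary
   cylindric partition of profile c with maximum \<le> m. Summing over m gives the geometric series. *)
theory Submission
  imports Defs
begin

text \<open>The right end of the slice with row lengths \<open>v\<close>, written without subtraction; that \<open>d\<close> is a list
  of naturals makes \<open>v\<close> a slice.\<close>

definition shape_end :: "nat list \<Rightarrow> nat list \<Rightarrow> nat list \<Rightarrow> bool" where
  "shape_end c v d \<longleftrightarrow> length v = length c \<and> length d = length c \<and>
     (\<forall>i < length c. let i' = Suc i mod length c in d ! i' + v ! i' = c ! i' + v ! i)"

text \<open>Inverse to removing cells with the largest part: when \<open>m\<close> bounds all parts
  of \<open>L\<close>, the new copies belong at the front, and sorted rows stay sorted.\<close>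

definition prepend :: "nat list \<Rightarrow> nat \<Rightarrow> nat list list \<Rightarrow> nat list list" where
  "prepend v m L = map2 (\<lambda>k xs. replicate k m @ xs) v L"

definition mults :: "nat \<Rightarrow> nat list list \<Rightarrow> nat list" where
  "mults m L = map (\<lambda>xs. count_list xs m) L"

subsection \<open>Right ends of slices\<close>

lemma Suc_pred_mod: "i < r \<Longrightarrow> Suc ((i + r - 1) mod r) mod r = (i::nat)"
  by (cases "i + r") (simp_all add: mod_Suc_eq, metis mod_add_self2 mod_less)

lemma pred_Suc_mod:
  assumes "i < (r::nat)" shows "(Suc i mod r + r - 1) mod r = i"
  using assms by (cases "Suc i = r") auto

text \<open>\<open>right_end\<close> compares a row with its cyclic predecessor,
  \<open>shape_end\<close> with its successor as in \<open>cylindric\<close>; the two systems of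
  equations differ only by the reindexing of \<open>Suc_pred_mod\<close> and
  \<open>pred_Suc_mod\<close>.\<close>

lemma shape_end_iff:
  assumes "length d = length c"
  shows "shape_end c v d \<longleftrightarrow> length v = length c \<and> (\<forall>i < length c. int (d ! i) =
      int (c ! i) + int (v ! ((i + length c - 1) mod length c)) - int (v ! i))" (is "_ \<longleftrightarrow> ?R")
proof
  assume S: "shape_end c v d"
  show ?R
  proof (intro conjI allI impI)
    show "length v = length c" using S by (simp add: shape_end_def)
    fix i assume i: "i < length c"
    let ?j = "(i + length c - 1) mod length c"
    have "?j < length c" using i by (intro mod_less_divisor) linarith
    with S have "d ! (Suc ?j mod length c) + v ! (Suc ?j mod length c) =
        c ! (Suc ?j mod length c) + v ! ?j"
      unfolding shape_end_def Let_def by blast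
    then show "int (d ! i) = int (c ! i) + int (v ! ?j) - int (v ! i)"
      unfolding Suc_pred_mod[OF i] by linarith
  qed
next
  assume R: ?R
  show "shape_end c v d"
    unfolding shape_end_def Let_def
  proof (intro conjI assms allI impI)
    show "length v = length c" using R by blast
    fix i assume i: "i < length c"
    let ?j = "Suc i mod length c"
    have "?j < length c" using i by (intro mod_less_divisor) linarith
    with R have "int (d ! ?j) =
      int (c ! ?j) + int (v ! ((?j + length c - 1) mod length c)) - int (v ! ?j)" by blast
    then show "d ! ?j + v ! ?j = c ! ?j + v ! i"
      unfolding pred_Suc_mod[OF i] by linarith
  qed
qed

text \<open>Subtracting the two equations at row i cancels the profiles, so the difference does not
  change from row i to row i + 1. The induction never needs the wrap-around equation.\<close>

lemma shape_end_diff_const: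
  assumes "shape_end c v d" "shape_end c w d" "i < length c"
  shows "int (v ! i) - int (w ! i) = int (v ! 0) - int (w ! 0)"
  using assms(3)
proof (induction i)
  case (Suc i)
  then have "Suc i mod length c = Suc i" "i < length c" by auto
  then have "d ! Suc i + v ! Suc i = c ! Suc i + v ! i" "d ! Suc i + w ! Suc i = c ! Suc i + w ! i"
    using assms(1,2) unfolding shape_end_def Let_def by metis+
  with Suc show ?case by linarith
qed simp

text \<open>The difference of \<open>v\<close> and \<open>w\<close> is constant. It is at most 0 at
  a zero of \<open>v\<close> and at least 0 at a zero of \<open>w\<close>.\<close>

lemma shape_end_unique:
  assumes "shape_end c v d" "shape_end c w d" "0 \<in> set v" "0 \<in> set w"
  shows "v = w"
proof (rule nth_equalityI)
  have len: "length v = length c" "length w = length c"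
    using assms by (auto simp: shape_end_def)
  then show "length v = length w" by simp
  obtain i j where ij: "i < length c" "v ! i = 0" "j < length c" "w ! j = 0"
    using assms(3,4) len by (metis in_set_conv_nth)
  have "int (v ! 0) - int (w ! 0) = 0"
    using shape_end_diff_const[OF assms(1,2) ij(1)] shape_end_diff_const[OF assms(1,2) ij(3)] ij
    by linarith
  then show "v ! k = w ! k" if "k < length v" for k
    using shape_end_diff_const[OF assms(1,2), of k] that len by simp
qed

text \<open>A constant tuple cancels from every equation. The case k = 1 is the removal of a full
  column, the case k = 0 the empty slice.\<close>

lemma shape_end_replicate:
  "shape_end c (replicate (length c) k) d \<longleftrightarrow> d = c"
proof -
  define v where v: "v = replicate (length c) k"
  have "d = c" if "shape_end c v d"
  proof (rule nth_equalityI)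
    show "length d = length c" using that by (simp add: shape_end_def)
    fix i assume "i < length d"
    then have i: "i < length c" using that by (simp add: shape_end_def)
    then have j: "(i + length c - 1) mod length c < length c"
      by (intro mod_less_divisor) linarith
    with that v i have "d ! (Suc ((i + length c - 1) mod length c) mod length c) =
       c ! (Suc ((i + length c - 1) mod length c) mod length c)"
      unfolding shape_end_def Let_def
      by (metis Suc_pred_mod add_right_cancel nth_replicate)
    then show "d ! i = c ! i" by (simp only: Suc_pred_mod[OF i])
  qed
  moreover have "shape_end c v c"
    unfolding shape_end_def Let_def v
    by (auto simp: nth_replicate[OF mod_less_divisor[OF gr_zeroI]])
  ultimately show ?thesis unfolding v by blast
qed

text \<open>Sum the equations over all rows: the cyclic shift permutes the rows, so the
  contributions of \<open>v\<close> cancel. Hence a right end has the same level as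
  \<open>c\<close>.\<close>

lemma shape_end_sum_list:
  assumes "shape_end c v d"
  shows "sum_list d = sum_list c"
proof -
  let ?r = "length c"
  have len: "length v = ?r" "length d = ?r" using assms by (auto simp: shape_end_def)
  have rot: "(\<Sum>i<?r. f (Suc i mod ?r)) = (\<Sum>i<?r. f i)" for f :: "nat \<Rightarrow> nat"
    by (rule sum.reindex_bij_witness[where i = "\<lambda>i. (i + ?r - 1) mod ?r" and j = "\<lambda>i. Suc i mod ?r"])
       (auto simp: pred_Suc_mod Suc_pred_mod simp del: One_nat_def intro!: mod_less_divisor)
  have "(\<Sum>i<?r. d ! (Suc i mod ?r) + v ! (Suc i mod ?r)) = (\<Sum>i<?r. c ! (Suc i mod ?r) + v ! i)"
    using assms by (intro sum.cong) (auto simp: shape_end_def Let_def)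
  then have "(\<Sum>i<?r. d ! i) = (\<Sum>i<?r. c ! i)"
    unfolding sum.distrib rot[of "\<lambda>i. d ! i"] rot[of "\<lambda>i. v ! i"] rot[of "\<lambda>i. c ! i"] by simp
  then show ?thesis by (simp add: sum_list_sum_nth len atLeast0LessThan)
qed

text \<open>If a minimal tuple had no zero entry, subtracting 1 from every entry would keep the
  right end and, as there is at least one row, lower the weight.\<close>

lemma Delta_shape:
  assumes "is_profile r l c" "is_profile r l d" "r \<ge> 1"
  shows "\<exists>v. shape_end c v d \<and> 0 \<in> set v \<and> sum_list v = Delta d c"
proof -
  have len: "length c = r" "length d = length c" using assms by (auto simp: is_profile_def)
  let ?P = "\<lambda>w. \<exists>v. shape_end c v d \<and> sum_list v = w"
  have "Delta d c = (LEAST w. ?P w)"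
    unfolding Delta_row_lengths[OF len(2)] shape_end_iff[OF len(2)] conj_assoc ..
  moreover have "\<exists>w. ?P w"
  proof -
    obtain L where L: "is_slice c L" "right_end c L d" using Delta_attained assms by blast
    then have "length L = length c" by (simp add: is_slice_def cylindric_def)
    moreover have "(i + length c - 1) mod length c < length c" if "i < length c" for i
      using that by (intro mod_less_divisor) linarith
    ultimately have "shape_end c (map length L) d"
      using L len(2) by (subst shape_end_iff) (auto simp: right_end_def simp del: One_nat_def)
    then show ?thesis by blast
  qed
  ultimately have P: "?P (Delta d c)" and least: "\<And>w. ?P w \<Longrightarrow> Delta d c \<le> w"
    using LeastI_ex[of ?P] Least_le[of ?P] by simp_all
  from P obtain v where v: "shape_end c v d" "sum_list v = Delta d c" by blast
  have "0 \<in> set v"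
  proof (rule ccontr)
    assume 0: "0 \<notin> set v"
    have lv: "length v = r" using v len by (simp add: shape_end_def)
    define w where "w = map (\<lambda>k. k - 1) v"
    have vw: "v ! i = Suc (w ! i)" if "i < r" for i
      using 0 that lv unfolding w_def by (metis Suc_pred' nth_map nth_mem neq0_conv One_nat_def)
    have "shape_end c w d"
      unfolding shape_end_def Let_def
    proof (intro conjI allI impI)
      show "length w = length c" by (simp add: w_def lv len)
      fix i assume i: "i < length c"
      then have "Suc i mod length c < r" using len by (simp add: mod_less_divisor)
      then show "d ! (Suc i mod length c) + w ! (Suc i mod length c) =
          c ! (Suc i mod length c) + w ! i"
        using v(1) i vw len unfolding shape_end_def Let_def
        by (metis add_Suc_right nat.inject)
    qed (fact len)
    moreover have "sum_list w < sum_list v"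
    proof -
      have "w ! i < v ! i" if "i < r" for i using vw[OF that] by simp
      then have "(\<Sum>i<r. w ! i) < (\<Sum>i<r. v ! i)"
        using assms(3) by (intro sum_strict_mono) (auto simp: lessThan_empty_iff)
      moreover have "length w = r" by (simp add: w_def lv)
      ultimately show ?thesis by (simp add: sum_list_sum_nth lv atLeast0LessThan)
    qed
    ultimately show False using least v(2) by (metis leD)
  qed
  with v show ?thesis by blast
qed

subsection \<open>Prepending a constant slice\<close>

lemma length_prepend [simp]: "length (prepend v m L) = min (length v) (length L)"
  by (simp add: prepend_def)

lemma nth_prepend [simp]:
  "i < length v \<Longrightarrow> i < length L \<Longrightarrow> prepend v m L ! i = replicate (v ! i) m @ L ! i"
  by (simp add: prepend_def)

lemma weight_prepend:
  "length v = length L \<Longrightarrow> weight (prepend v m L) = weight L + sum_list v * m"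
  by (induction v L rule: list_induct2)
     (auto simp: weight_def prepend_def sum_list_replicate algebra_simps)

lemma parts_of_prepend:
  "length v = length L \<Longrightarrow>
    parts_of (prepend v m L) = parts_of L \<union> (if \<exists>k \<in> set v. k > 0 then {m} else {})"
  by (induction v L rule: list_induct2) (auto simp: parts_of_def prepend_def)

text \<open>The length is fixed because \<open>map2\<close> stops at the shorter list, so rows of
  \<open>L\<close> beyond the length of \<open>v\<close> would be lost.\<close>

lemma inj_on_prepend: "inj_on (prepend v m) {L. length L = length v}"
proof (rule inj_onI)
  fix L L' :: "nat list list"
  assume len: "L \<in> {L. length L = length v}" "L' \<in> {L. length L = length v}"
    and eq: "prepend v m L = prepend v m L'"
  show "L = L'"
  proof (rule nth_equalityI)
    show "length L = length L'" using len by simp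
    fix i assume "i < length L"
    then show "L ! i = L' ! i"
      using len nth_prepend[of i v L m] nth_prepend[of i v L' m] unfolding eq by simp
  qed
qed

lemma mults_prepend:
  assumes "length v = length L" "m \<notin> parts_of L"
  shows "mults m (prepend v m L) = v"
proof (rule nth_equalityI)
  show "length (mults m (prepend v m L)) = length v" using assms by (simp add: mults_def)
  fix i assume "i < length (mults m (prepend v m L))"
  then have i: "i < length v" "i < length L" using assms by (auto simp: mults_def)
  then have "m \<notin> set (L ! i)" using assms(2) by (auto simp: parts_of_def)
  moreover have "count_list (replicate k m) m = k" for k by (induction k) auto
  ultimately show "mults m (prepend v m L) ! i = v ! i"
    using i by (simp add: mults_def count_notin)
qed

lemma is_partition_prepend:
  "m > 0 \<Longrightarrow> \<forall>x \<in> set xs. x \<le> m \<Longrightarrow> is_partition (replicate k m @ xs) \<longleftrightarrow> is_partition xs"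
  by (induction k) (auto simp: is_partition_def)

lemma part_le: "\<forall>x \<in> set xs. x \<le> m \<Longrightarrow> part xs j \<le> m"
  by (simp add: nth_default_def)

lemma part_replicate_append:
  "part (replicate k m @ xs) j = (if j < k then m else part xs (j - k))"
  by (simp add: nth_default_append)

text \<open>Row i moves by \<open>v ! i\<close> positions, so the offset \<open>c ! i'\<close>
  between row i and its successor i' turns into \<open>c ! i' + v ! i - v ! i'\<close>, which is
  \<open>d ! i'\<close>.\<close>

lemma cylindric_prepend:
  assumes S: "shape_end c v d" and len: "length L = length c"
    and le: "\<forall>x \<in> parts_of L. x \<le> m" and m: "m > 0"
  shows "cylindric c (prepend v m L) \<longleftrightarrow> cylindric d L"
proof -
  let ?r = "length c"
  have lens: "length v = ?r" "length d = ?r" using S by (auto simp: shape_end_def)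
  have le': "\<forall>x \<in> set (L ! i). x \<le> m" if "i < ?r" for i
    using that le len by (auto simp: parts_of_def)
  have "(\<forall>xs \<in> set (prepend v m L). is_partition xs) \<longleftrightarrow> (\<forall>xs \<in> set L. is_partition xs)"
    unfolding all_set_conv_all_nth using lens len le' m by (auto simp: is_partition_prepend)
  moreover have "(\<forall>j. part (prepend v m L ! i) j \<ge> part (prepend v m L ! (Suc i mod ?r)) (j + c ! (Suc i mod ?r)))
    \<longleftrightarrow> (\<forall>j. part (L ! i) j \<ge> part (L ! (Suc i mod ?r)) (j + d ! (Suc i mod ?r)))" (is "(\<forall>j. ?P j) \<longleftrightarrow> (\<forall>j. ?Q j)")
    if i: "i < ?r" for i
  proof -
    define i' where "i' = Suc i mod ?r"
    have i': "i' < ?r" using i unfolding i'_def by (intro mod_less_divisor) linarith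
    have e: "d ! i' + v ! i' = c ! i' + v ! i"
      using S i unfolding shape_end_def Let_def i'_def by blast
    have P: "part (prepend v m L ! k) j = (if j < v ! k then m else part (L ! k) (j - v ! k))"
      if "k < ?r" for k j
      using that lens len by (simp add: part_replicate_append)
    \<comment> \<open>At these positions the left side is \<open>m\<close>, the largest possible
      value.\<close>
    have lo: "?P j" if "j < v ! i" for j
      using that i i' le'[OF i'] unfolding i'_def[symmetric] P[OF i] P[OF i']
      by (simp add: part_le)
    \<comment> \<open>All other positions have the form \<open>v ! i + j\<close>. There
      \<open>e\<close> gives \<open>v ! i' \<le> c ! i' + v ! i\<close>, so the natural subtraction
      does not truncate.\<close>
    have hi: "?P (v ! i + j) \<longleftrightarrow> ?Q j" for j
    proof -
      have "v ! i + j + c ! i' - v ! i' = j + d ! i'" "\<not> v ! i + j + c ! i' < v ! i'"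
        using e by linarith+
      then show ?thesis unfolding i'_def[symmetric] P[OF i] P[OF i'] by simp
    qed
    show ?thesis
      using lo hi by (metis le_Suc_ex not_le)
  qed
  ultimately show ?thesis
    using lens len by (simp add: cylindric_def Let_def)
qed

text \<open>In a weakly decreasing list bounded by \<open>m\<close>, all copies of \<open>m\<close>
  stand at the front.\<close>

lemma replicate_append_drop:
  assumes "is_partition xs" "\<forall>x \<in> set xs. x \<le> m" "k \<le> count_list xs m"
  shows "xs = replicate k m @ drop k xs"
  using assms
proof (induction xs arbitrary: k)
  case (Cons x xs)
  show ?case
  proof (cases k)
    case (Suc k')
    have x: "x = m"
    proof (rule ccontr)
      assume "x \<noteq> m"
      with Cons.prems Suc have "m \<in> set xs" by (metis Suc_le_D count_list.simps(2) count_notin nat.distinct(1))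
      with Cons.prems \<open>x \<noteq> m\<close> show False by (auto simp: is_partition_def)
    qed
    with Cons.prems Suc have "xs = replicate k' m @ drop k' xs"
      by (intro Cons.IH) (auto simp: is_partition_def)
    with x Suc show ?thesis by simp
  qed simp
qed simp

text \<open>Supplies the preimages for the surjectivity of both bijections below.\<close>

lemma prepend_drop:
  assumes "cylindric c M" "\<forall>x \<in> parts_of M. x \<le> m" "length v = length c"
    and "\<And>i. i < length c \<Longrightarrow> v ! i \<le> count_list (M ! i) m"
  shows "M = prepend v m (map2 drop v M)"
proof (rule nth_equalityI)
  show "length M = length (prepend v m (map2 drop v M))"
    using assms by (simp add: cylindric_def)
  fix i assume i: "i < length M"
  then have "M ! i = replicate (v ! i) m @ drop (v ! i) (M ! i)"
    using assms by (intro replicate_append_drop) (auto simp: cylindric_def parts_of_def)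
  with i show "M ! i = prepend v m (map2 drop v M) ! i"
    using assms by (simp add: cylindric_def)
qed

subsection \<open>The largest part\<close>

lemma finite_parts_of [simp]: "finite (parts_of L)"
  by (simp add: parts_of_def)

lemma max_part_less_iff: "m > 0 \<Longrightarrow> max_part L < m \<longleftrightarrow> (\<forall>x \<in> parts_of L. x < m)"
  by (auto simp: max_part_def)

text \<open>Positivity of \<open>m\<close> excludes the empty case, where the maximum is 0 by
  convention.\<close>

lemma max_part_eq_iff:
  "m > 0 \<Longrightarrow> max_part L = m \<longleftrightarrow> m \<in> parts_of L \<and> (\<forall>x \<in> parts_of L. x \<le> m)"
  by (auto simp: max_part_def Max_eq_iff intro!: Max_eqI)

text \<open>The copies of \<open>m\<close> fill an initial segment, and \<open>m > 0\<close> keeps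
  the default value 0 beyond the end of the list from being taken for \<open>m\<close>.\<close>

lemma part_eq_iff_count:
  assumes "is_partition xs" "\<forall>x \<in> set xs. x \<le> m" "m > 0"
  shows "part xs j = m \<longleftrightarrow> j < count_list xs m"
proof -
  define ys where "ys = drop (count_list xs m) xs"
  have xs: "xs = replicate (count_list xs m) m @ ys"
    using replicate_append_drop[OF assms(1,2) order_refl] unfolding ys_def .
  moreover have "count_list (replicate k m) m = k" for k by (induction k) auto
  ultimately have "count_list ys m = 0"
    by (metis add_cancel_right_right count_list_append)
  then have "part ys k \<noteq> m" for k
    using assms(3) by (auto simp: nth_default_def count_list_0_iff)
  then show ?thesis
    by (subst xs) (simp add: part_replicate_append)
qed

text \<open>At the position given by its multiplicity of \<open>m\<close>, row i is already below
  \<open>m\<close>. The cylindric inequality then bounds the multiplicity in the next row i' by that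
  of row i plus \<open>c ! i'\<close>, so the entries of the right end are nonnegative.\<close>

lemma mults_shape_end:
  assumes cyl: "cylindric c M" and le: "\<forall>x \<in> parts_of M. x \<le> m" and m: "m > 0"
  shows "\<exists>d. shape_end c (mults m M) d"
proof -
  let ?r = "length c" and ?v = "mults m M"
  have len: "length M = ?r" using cyl by (simp add: cylindric_def)
  have row: "is_partition (M ! i)" "\<forall>x \<in> set (M ! i). x \<le> m" if "i < ?r" for i
    using that cyl le len by (auto simp: cylindric_def parts_of_def)
  have v: "?v ! i = count_list (M ! i) m" if "i < ?r" for i using that len by (simp add: mults_def)
  have step: "?v ! (Suc i mod ?r) \<le> c ! (Suc i mod ?r) + ?v ! i" if i: "i < ?r" for i
  proof -
    define i' where "i' = Suc i mod ?r"
    have i': "i' < ?r" using i unfolding i'_def by (intro mod_less_divisor) linarith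
    have "part (M ! i) (?v ! i) \<ge> part (M ! i') (?v ! i + c ! i')"
      using cyl i unfolding cylindric_def Let_def i'_def by blast
    moreover have "part (M ! i) (?v ! i) \<noteq> m"
      using part_eq_iff_count[OF row[OF i] m] v[OF i] by simp
    ultimately have "part (M ! i') (?v ! i + c ! i') \<noteq> m"
      using part_le[OF row(2)[OF i], of "?v ! i"] by linarith
    then show ?thesis
      using part_eq_iff_count[OF row[OF i'] m] v[OF i'] unfolding i'_def[symmetric] by simp
  qed
  \<comment> \<open>By \<open>step\<close> this natural subtraction never truncates.\<close>
  define d where "d = map (\<lambda>i. c ! i + ?v ! ((i + ?r - 1) mod ?r) - ?v ! i) [0..<?r]"
  have "shape_end c ?v d"
    unfolding shape_end_def Let_def
  proof (intro conjI allI impI)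
    show "length ?v = ?r" "length d = ?r" by (auto simp: mults_def d_def len)
    fix i assume i: "i < ?r"
    have "Suc i mod ?r < ?r" using i by (intro mod_less_divisor) linarith
    then have "d ! (Suc i mod ?r) = c ! (Suc i mod ?r) + ?v ! i - ?v ! (Suc i mod ?r)"
      unfolding d_def using pred_Suc_mod[OF i] by simp
    with step[OF i] show "d ! (Suc i mod ?r) + ?v ! (Suc i mod ?r) = c ! (Suc i mod ?r) + ?v ! i"
      by simp
  qed
  then show ?thesis ..
qed

text \<open>Serves to show that different right ends come from different tuples, so that their
  classes are disjoint.\<close>

lemma shape_end_fun_unique:
  assumes "shape_end c v d" "shape_end c v e"
  shows "d = e"
proof (rule nth_equalityI)
  show "length d = length e" using assms by (simp add: shape_end_def)
  fix i assume "i < length d"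
  then have i: "i < length c" using assms by (simp add: shape_end_def)
  let ?j = "(i + length c - 1) mod length c"
  have "?j < length c" using i by (intro mod_less_divisor) linarith
  with assms have "d ! (Suc ?j mod length c) = e ! (Suc ?j mod length c)"
    unfolding shape_end_def Let_def by (metis add_right_cancel)
  then show "d ! i = e ! i" unfolding Suc_pred_mod[OF i] .
qed

section \<open>Bijections that remove copies of the largest part\<close>

lemma parts_of_map2_drop: "parts_of (map2 drop v M) \<subseteq> parts_of M"
  by (auto simp: parts_of_def dest!: in_set_dropD set_zip_rightD)

text \<open>Taking all copies of \<open>m\<close> off every row removes exactly the size
  \<open>m\<close>, so the maximum drops below \<open>m\<close> and one size is lost. Conversely, a
  positive entry of \<open>v\<close> makes \<open>m\<close> occur.\<close>

lemma image_prepend_less: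
  assumes S: "shape_end c v d" and m: "m > 0" and pos: "\<exists>k \<in> set v. k > 0"
  shows "prepend v m ` {L. cylindric d L \<and> max_part L < m \<and> Suc (num_sizes L) = s \<and>
      weight L + sum_list v * m = n} =
    {M. cylindric c M \<and> max_part M = m \<and> num_sizes M = s \<and> weight M = n \<and> mults m M = v}"
    (is "_ ` ?A = ?B")
proof (intro equalityI subsetI)
  have lens: "length v = length c" "length d = length c" using S by (auto simp: shape_end_def)
  fix M assume "M \<in> prepend v m ` ?A"
  then obtain L where M: "M = prepend v m L" and L: "L \<in> ?A" by blast
  have len: "length L = length c" using L lens by (simp add: cylindric_def)
  have lt: "\<forall>x \<in> parts_of L. x < m" using L m by (simp add: max_part_less_iff)
  then have P: "parts_of M = insert m (parts_of L)" "m \<notin> parts_of L" "\<forall>x \<in> parts_of L. x \<le> m"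
    using M pos lens len by (auto simp: parts_of_prepend)
  have "cylindric c M" using cylindric_prepend[OF S len P(3) m] L M by simp
  moreover have "max_part M = m" using P m by (simp add: max_part_eq_iff)
  moreover have "num_sizes M = s" using P L by (simp add: num_sizes_def)
  moreover have "weight M = n" using M L len lens by (simp add: weight_prepend)
  moreover have "mults m M = v" using M P lens len by (simp add: mults_prepend)
  ultimately show "M \<in> ?B" by simp
next
  have lens: "length v = length c" "length d = length c" using S by (auto simp: shape_end_def)
  fix M assume B: "M \<in> ?B"
  then have le: "\<forall>x \<in> parts_of M. x \<le> m" using m by (simp add: max_part_eq_iff)
  have lM: "length M = length c" using B by (simp add: cylindric_def)
  have v: "v ! i = count_list (M ! i) m" if "i < length c" for i
    using B that lM by (auto simp: mults_def)
  define L where "L = map2 drop v M"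
  have len: "length L = length c" using lM lens by (simp add: L_def)
  have M: "M = prepend v m L"
    unfolding L_def using B le lens v by (intro prepend_drop[of c]) auto
  have cnt: "count_list (replicate k m) m = k" for k by (induction k) auto
  \<comment> \<open>The prefix of row i already accounts for every copy of \<open>m\<close> that
    \<open>v ! i\<close> counts.\<close>
  have notin: "m \<notin> parts_of L"
  proof
    assume "m \<in> parts_of L"
    then obtain i where i: "i < length c" "m \<in> set (L ! i)"
      unfolding parts_of_def by (metis UN_E in_set_conv_nth len)
    have "M ! i = replicate (v ! i) m @ L ! i" using i M lens len by simp
    with v[OF i(1)] have "count_list (L ! i) m = 0"
      by (metis add_cancel_right_right count_list_append cnt)
    with i show False by (simp add: count_list_0_iff)
  qed
  have leL: "\<forall>x \<in> parts_of L. x \<le> m" using le parts_of_map2_drop[of v M] unfolding L_def by blast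
  have P: "parts_of M = insert m (parts_of L)"
    unfolding M using pos lens len by (simp add: parts_of_prepend)
  have "cylindric d L" using cylindric_prepend[OF S len leL m] B M by simp
  moreover have "max_part L < m" using leL notin m by (metis max_part_less_iff le_neq_implies_less)
  moreover have "Suc (num_sizes L) = s" using P notin B by (auto simp: num_sizes_def)
  moreover have "weight L + sum_list v * m = n"
    using B M weight_prepend[of v L m] len lens by simp
  ultimately show "M \<in> prepend v m ` ?A" using M by blast
qed

text \<open>When every row contains \<open>m\<close>, one copy is taken from each, and the profile
  stays \<open>c\<close> because the removed tuple is constant. Either \<open>m\<close> survives in
  some row and no size is lost, or the maximum drops below \<open>m\<close> and one size is
  lost.\<close>

lemma image_prepend_column:
  assumes m: "m > 0" and c: "length c = r" "r > 0"
  shows "prepend (replicate r 1) m ` {L. cylindric c L \<and>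
      (max_part L = m \<and> num_sizes L = s \<or> max_part L < m \<and> Suc (num_sizes L) = s) \<and>
      weight L + r * m = n} =
    {M. cylindric c M \<and> max_part M = m \<and> num_sizes M = s \<and> weight M = n \<and> 0 \<notin> set (mults m M)}"
    (is "prepend ?v m ` ?A = ?B")
proof -
  have S: "shape_end c ?v c" unfolding c(1)[symmetric] shape_end_replicate ..
  have parts: "parts_of (prepend ?v m L) = insert m (parts_of L)" if "length L = r" for L
    using that c by (auto simp: parts_of_prepend)
  have sizes: "(max_part L = m \<and> num_sizes L = s \<or> max_part L < m \<and> Suc (num_sizes L) = s) \<longleftrightarrow>
      num_sizes (prepend ?v m L) = s" if "length L = r" "\<forall>x \<in> parts_of L. x \<le> m" for L
  proof (cases "m \<in> parts_of L")
    case True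
    then have "max_part L = m" using that m by (simp add: max_part_eq_iff)
    then show ?thesis using True that by (simp add: num_sizes_def parts insert_absorb del: One_nat_def)
  next
    case False
    then have "max_part L < m" using that m by (metis max_part_less_iff le_neq_implies_less)
    then show ?thesis using False that by (simp add: num_sizes_def parts del: One_nat_def)
  qed
  have main: "L \<in> ?A \<longleftrightarrow> prepend ?v m L \<in> ?B \<and> (\<forall>x \<in> parts_of L. x \<le> m)" if len: "length L = r" for L
  proof (cases "\<forall>x \<in> parts_of L. x \<le> m")
    case True
    have "cylindric c (prepend ?v m L) \<longleftrightarrow> cylindric c L"
      using cylindric_prepend[OF S _ True m] len c by simp
    moreover have "max_part (prepend ?v m L) = m" using parts[OF len] True m by (simp add: max_part_eq_iff)
    moreover have "weight (prepend ?v m L) = weight L + r * m"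
      using len by (simp add: weight_prepend sum_list_replicate)
    moreover have "0 \<notin> set (mults m (prepend ?v m L))"
      using len by (auto simp: mults_def in_set_conv_nth)
    ultimately show ?thesis using sizes[OF len True] True by auto
  next
    case False
    then show ?thesis using m by (auto simp: max_part_eq_iff max_part_less_iff dest: less_imp_le)
  qed
  show ?thesis
  proof (intro equalityI subsetI)
    fix M assume "M \<in> prepend ?v m ` ?A"
    then obtain L where "M = prepend ?v m L" "L \<in> ?A" by blast
    moreover from this have "length L = r" using c by (simp add: cylindric_def)
    ultimately show "M \<in> ?B" using main by blast
  next
    fix M assume B: "M \<in> ?B"
    then have le: "\<forall>x \<in> parts_of M. x \<le> m" using m by (simp add: max_part_eq_iff)
    have lM: "length M = r" using B c by (simp add: cylindric_def)
    have "count_list (M ! i) m \<noteq> 0" if "i < r" for i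
      using B that lM by (auto simp: mults_def)
    then have "?v ! i \<le> count_list (M ! i) m" if "i < length c" for i
      using that c by (simp add: Suc_le_eq)
    then have M: "M = prepend ?v m (map2 drop ?v M)"
      using B le c by (intro prepend_drop[of c]) auto
    have "map2 drop ?v M \<in> ?A"
      using main[of "map2 drop ?v M", folded M] B le parts_of_map2_drop[of ?v M] lM by auto
    with M show "M \<in> prepend ?v m ` ?A" by blast
  qed
qed

section \<open>Recurrence for the number of cylindric partitions\<close>

definition num_cyl :: "nat list \<Rightarrow> nat \<Rightarrow> nat \<Rightarrow> nat \<Rightarrow> nat" where
  "num_cyl c m s n = card {L. cylindric c L \<and> max_part L = m \<and> num_sizes L = s \<and> weight L = n}"

text \<open>The additive form of the conditions matches the preimages in the bijections; the case
  distinction isolates the empty sets, where \<open>s - 1\<close> or \<open>n - k\<close> would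
  truncate.\<close>

lemma card_max_part_less:
  "card {L. cylindric c L \<and> max_part L < m \<and> Suc (num_sizes L) = s \<and> weight L + k = n} =
    (if s = 0 \<or> n < k then 0 else \<Sum>j<m. num_cyl c j (s - 1) (n - k))"
proof (cases "s = 0 \<or> n < k")
  case False
  let ?A = "\<lambda>j. {L. cylindric c L \<and> max_part L = j \<and> num_sizes L = s - 1 \<and> weight L = n - k}"
  have fin: "finite (?A j)" for j
    by (rule finite_subset[OF _ finite_cylindric[of c "n - k"]]) auto
  have "{L. cylindric c L \<and> max_part L < m \<and> Suc (num_sizes L) = s \<and> weight L + k = n} =
      (\<Union>j<m. ?A j)"
    using False by auto
  then show ?thesis
    using False fin by (simp add: card_UN_disjoint num_cyl_def disjoint_iff)
qed (auto simp: card_eq_0_iff)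

lemma card_max_part_eq:
  "card {L. cylindric c L \<and> max_part L = m \<and> num_sizes L = s \<and> weight L + k = n} =
    (if n < k then 0 else num_cyl c m s (n - k))"
  unfolding num_cyl_def by (auto intro!: arg_cong[where f = card])

text \<open>This is the coefficient of z^m u^s q^n in the functional equation. The first two
  summands count the partitions with \<open>m\<close> in every row, according to whether
  \<open>m\<close> survives the removal of a column; the last sum collects those with a row free of
  \<open>m\<close>, by right end.\<close>

lemma num_cyl_recurrence:
  assumes m: "m > 0" and r: "r \<ge> 1" and c: "is_profile r l c"
  shows "num_cyl c m s n =
    (if n < r * m then 0 else num_cyl c m s (n - r * m)) +
    (if s = 0 \<or> n < r * m then 0 else \<Sum>j<m. num_cyl c j (s - 1) (n - r * m)) +
    (\<Sum>d \<in> {d. is_profile r l d} - {c}. if s = 0 \<or> n < Delta d c * m then 0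
       else \<Sum>j<m. num_cyl d j (s - 1) (n - Delta d c * m))"
proof -
  let ?D = "{d. is_profile r l d} - {c}"
  let ?M = "\<lambda>M. cylindric c M \<and> max_part M = m \<and> num_sizes M = s \<and> weight M = n"
  have lc: "length c = r" using c by (simp add: is_profile_def)
  \<comment> \<open>Choose for each \<open>d\<close> the minimal tuple; by
    \<open>shape_end_unique\<close> it is the only one with right end \<open>d\<close> and a zero
    entry.\<close>
  have "\<forall>d \<in> ?D. \<exists>v. shape_end c v d \<and> 0 \<in> set v \<and> sum_list v = Delta d c"
    using Delta_shape[OF c _ r] by blast
  from bchoice[OF this] obtain v
    where vD: "\<forall>d \<in> ?D. shape_end c (v d) d \<and> 0 \<in> set (v d) \<and> sum_list (v d) = Delta d c" ..
  have v: "shape_end c (v d) d" "0 \<in> set (v d)" "sum_list (v d) = Delta d c" if "d \<in> ?D" for d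
    using bspec[OF vD that] by simp_all
  have zero: "shape_end c (replicate r 0) c"
    unfolding lc[symmetric] shape_end_replicate ..
  let ?full = "{M. ?M M \<and> 0 \<notin> set (mults m M)}"
  let ?top = "\<lambda>d. {M. ?M M \<and> mults m M = v d}"
  have fin: "finite {M. ?M M \<and> P M}" for P
    by (rule finite_subset[OF _ finite_cylindric[of c n]]) auto
  have full: "card ?full = (if n < r * m then 0 else num_cyl c m s (n - r * m)) +
    (if s = 0 \<or> n < r * m then 0 else \<Sum>j<m. num_cyl c j (s - 1) (n - r * m))"
  proof -
    let ?A = "{L. cylindric c L \<and> max_part L = m \<and> num_sizes L = s \<and> weight L + r * m = n}"
    let ?B = "{L. cylindric c L \<and> max_part L < m \<and> Suc (num_sizes L) = s \<and> weight L + r * m = n}"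
    have "?full = prepend (replicate r 1) m ` (?A \<union> ?B)"
      using image_prepend_column[OF m lc, of s n] r by (auto intro!: arg_cong[where f = "image _"])
    moreover have "inj_on (prepend (replicate r 1) m) (?A \<union> ?B)"
      using lc by (intro inj_on_subset[OF inj_on_prepend]) (auto simp: cylindric_def)
    moreover have "card (?A \<union> ?B) = card ?A + card ?B"
      by (intro card_Un_disjoint; (rule finite_subset[OF _ finite_cylindric[of c "n - r * m"]])?) auto
    ultimately show ?thesis by (simp only: card_image card_max_part_less card_max_part_eq)
  qed
  have top: "card (?top d) = (if s = 0 \<or> n < Delta d c * m then 0
       else \<Sum>j<m. num_cyl d j (s - 1) (n - Delta d c * m))" if d: "d \<in> ?D" for d
  proof -
    let ?B = "{L. cylindric d L \<and> max_part L < m \<and> Suc (num_sizes L) = s \<and> weight L + Delta d c * m = n}"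
    have lv: "length (v d) = r" "length d = r" using v(1)[OF d] lc by (auto simp: shape_end_def)
    have "\<exists>k \<in> set (v d). k > 0"
    proof (rule ccontr)
      assume "\<not> (\<exists>k \<in> set (v d). k > 0)"
      then have "v d = replicate r 0" using lv by (metis gr0I replicate_eqI)
      then have "d = c" using v(1)[OF d] zero shape_end_fun_unique by metis
      with d show False by simp
    qed
    from image_prepend_less[OF v(1)[OF d] m this, of s n]
    have "?top d = prepend (v d) m ` ?B" unfolding v(3)[OF d] by auto
    moreover have "inj_on (prepend (v d) m) ?B"
      using lv by (intro inj_on_subset[OF inj_on_prepend]) (auto simp: cylindric_def)
    ultimately show ?thesis by (simp only: card_image card_max_part_less)
  qed
  have "\<exists>d \<in> ?D. mults m M = v d" if M: "?M M" and 0: "0 \<in> set (mults m M)" for M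
  proof -
    have le: "m \<in> parts_of M" "\<forall>x \<in> parts_of M. x \<le> m" using M m max_part_eq_iff by auto
    then obtain d where d: "shape_end c (mults m M) d" using mults_shape_end M m by blast
    \<comment> \<open>The zero tuple also has right end \<open>c\<close>, so equality would make all
      multiplicities vanish, although \<open>m\<close> occurs in \<open>M\<close>.\<close>
    have "d \<noteq> c"
    proof
      assume "d = c"
      then have "mults m M = replicate r 0"
        using shape_end_unique[OF d _ 0, of "replicate r 0"] zero r by simp
      moreover obtain xs where "xs \<in> set M" "m \<in> set xs" using le by (auto simp: parts_of_def)
      then have "count_list xs m \<noteq> 0" "count_list xs m \<in> set (mults m M)"
        by (auto simp: mults_def count_list_0_iff)
      ultimately show False by simp
    qed
    moreover have "is_profile r l d"
      using c d shape_end_sum_list[OF d] by (simp add: is_profile_def shape_end_def)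
    ultimately have D: "d \<in> ?D" by simp
    then show ?thesis using shape_end_unique[OF d v(1)[OF D] 0 v(2)[OF D]] by blast
  qed
  then have "{M. ?M M} = ?full \<union> (\<Union>d \<in> ?D. ?top d)" by blast
  then have "num_cyl c m s n = card (?full \<union> (\<Union>d \<in> ?D. ?top d))" by (simp add: num_cyl_def)
  also have "\<dots> = card ?full + card (\<Union>d \<in> ?D. ?top d)"
  proof (intro card_Un_disjoint finite_UN_I finite_Diff finite_profiles fin)
    \<comment> \<open>Every \<open>v d\<close> contains a zero, which the tuples in
      \<open>?full\<close> do not.\<close>
    show "?full \<inter> (\<Union>d \<in> ?D. ?top d) = {}" using vD by fastforce
  qed
  also have "card (\<Union>d \<in> ?D. ?top d) = (\<Sum>d \<in> ?D. card (?top d))"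
  proof (intro card_UN_disjoint ballI impI)
    fix d e assume "d \<in> ?D" "e \<in> ?D" "d \<noteq> e"
    then have "v d \<noteq> v e" using v(1) shape_end_fun_unique by metis
    then show "?top d \<inter> ?top e = {}" by auto
  qed (use fin finite_profiles in auto)
  also have "\<dots> = (\<Sum>d \<in> ?D. if s = 0 \<or> n < Delta d c * m then 0
       else \<Sum>j<m. num_cyl d j (s - 1) (n - Delta d c * m))"
    by (intro sum.cong refl top)
  finally show ?thesis unfolding full .
qed

subsection \<open>Coefficients\<close>

lemma F_nth: "fps_nth (fps_nth (fps_nth (F c) m) s) n = of_nat (num_cyl c m s n)"
  by (simp add: F_def num_cyl_def)

lemma qvar_power: "qvar ^ k = fps_const (fps_const (fps_X ^ k))"
  by (simp add: qvar_def fps_const_power)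

text \<open>The quotient Q satisfies Q = q^k + z q^k Q, which determines its coefficients
  recursively.\<close>

lemma geometric_nth:
  "fps_nth (qvar ^ k / (1 - zvar * qvar ^ k)) m = fps_const (fps_X ^ (k * Suc m))"
proof -
  let ?Q = "qvar ^ k / (1 - zvar * qvar ^ k)"
  have "?Q = qvar ^ k + fps_X * (qvar ^ k * ?Q)"
    using div_one_minus[of "qvar ^ k" k] by (simp add: algebra_simps zvar_def)
  then have "fps_nth ?Q m = fps_nth (qvar ^ k + fps_X * (qvar ^ k * ?Q)) m" for m by metis
  then have rec: "fps_nth ?Q m = fps_nth (qvar ^ k) m +
      (if m = 0 then 0 else fps_nth (qvar ^ k * ?Q) (m - 1))" for m
    by simp
  show ?thesis
    by (induction m; subst rec) (simp_all add: qvar_power power_add mult_ac)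
qed

text \<open>The factor z leaves the coefficient of z^(m-1) of a product. There the substitution
  contributes q^(kj) and the geometric series q^(k(m-j)), so q^(km) factors out of the sum over
  j.\<close>

lemma block_nth:
  "fps_nth (uvar * zvar * (qvar ^ k / (1 - zvar * qvar ^ k) * F_at d (zvar * qvar ^ k))) m =
    fps_X * (fps_const (fps_X ^ (k * m)) * (\<Sum>j<m. fps_nth (F d) j))"
proof (cases m)
  case 0
  then show ?thesis by (simp add: zvar_def uvar_def)
next
  case (Suc p)
  have "fps_nth (qvar ^ k / (1 - zvar * qvar ^ k) * F_at d (zvar * qvar ^ k)) p =
     (\<Sum>j=0..p. fps_nth (F_at d (zvar * qvar ^ k)) j * fps_nth (qvar ^ k / (1 - zvar * qvar ^ k)) (p - j))"
    by (subst mult.commute) (simp only: fps_mult_nth)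
  also have "\<dots> = (\<Sum>j=0..p. fps_const (fps_X ^ (k * m)) * fps_nth (F d) j)"
  proof (intro sum.cong refl)
    fix j assume "j \<in> {0..p}"
    then obtain q where "p = j + q" using le_Suc_ex by auto
    then have "k * m = k * j + k * Suc (p - j)" by (simp add: Suc algebra_simps)
    then show "fps_nth (F_at d (zvar * qvar ^ k)) j * fps_nth (qvar ^ k / (1 - zvar * qvar ^ k)) (p - j) =
        fps_const (fps_X ^ (k * m)) * fps_nth (F d) j"
      unfolding F_at_shift_nth geometric_nth by (simp add: power_add mult_ac flip: fps_const_mult)
  qed
  also have "\<dots> = fps_const (fps_X ^ (k * m)) * (\<Sum>j<m. fps_nth (F d) j)"
    by (simp add: sum_distrib_left Suc lessThan_Suc_atMost atMost_atLeast0)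
  finally show ?thesis
    by (simp add: Suc zvar_def uvar_def mult.assoc)
qed

text \<open>The outer \<open>fps_X\<close> is u, which shifts s by one; the one inside
  \<open>fps_const\<close> is q.\<close>

lemma block_nth_nth:
  "fps_nth (fps_nth (fps_X * (fps_const (fps_X ^ (k * m)) * (\<Sum>j<m. fps_nth (F d) j))) s) n =
    of_nat (if s = 0 \<or> n < k * m then 0 else \<Sum>j<m. num_cyl d j (s - 1) (n - k * m))"
  by (simp add: fps_X_power_mult_nth fps_sum_nth F_nth)

section \<open>The functional equation\<close>

theorem mainTheorem6:
  fixes r l :: nat and c :: "nat list"
  assumes "r \<ge> 1" and "l \<ge> 1" and "is_profile r l c"
  shows "F c =
    (1 - (1 - uvar) * zvar * qvar ^ r) / (1 - zvar * qvar ^ r) * F_at c (zvar * qvar ^ r)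
    + uvar * zvar * (\<Sum>d \<in> {d. is_profile r l d} - {c}.
        qvar ^ Delta d c / (1 - zvar * qvar ^ Delta d c) * F_at d (zvar * qvar ^ Delta d c))"
proof -
  let ?D = "{d. is_profile r l d} - {c}"
  define B where "B = (\<lambda>d k. uvar * zvar * (qvar ^ k / (1 - zvar * qvar ^ k) * F_at d (zvar * qvar ^ k)))"
  let ?g = "1 - zvar * qvar ^ r"
  have "fps_nth ?g 0 = 1" by (simp add: zvar_def)
  then have g: "?g \<noteq> 0" by (metis fps_zero_nth zero_neq_one)
  \<comment> \<open>Since 1 - (1 - u) z q^r = (1 - z q^r) + u z q^r, the first term splits into
    \<open>F_at c (zvar * qvar ^ r)\<close> and a block of the same shape as the summands for
    \<open>d\<close>, with exponent r.\<close>
  have "(1 - (1 - uvar) * zvar * qvar ^ r) / ?g = 1 + uvar * zvar * (qvar ^ r / ?g)"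
  proof -
    have "(1 - (1 - uvar) * zvar * qvar ^ r) / ?g * ?g =
        ?g + uvar * zvar * (qvar ^ r / ?g * ?g)"
      unfolding div_one_minus by (simp add: algebra_simps)
    also have "\<dots> = (1 + uvar * zvar * (qvar ^ r / ?g)) * ?g"
      by (simp only: distrib_right mult_1_left mult.assoc)
    finally show ?thesis by (simp only: mult_right_cancel[OF g])
  qed
  then have first: "(1 - (1 - uvar) * zvar * qvar ^ r) / ?g * F_at c (zvar * qvar ^ r) =
      F_at c (zvar * qvar ^ r) + B c r"
    by (simp only: B_def distrib_right mult_1_left mult.assoc)
  have "F c = F_at c (zvar * qvar ^ r) + B c r + (\<Sum>d \<in> ?D. B d (Delta d c))"
  proof (rule fps_ext)
    fix m
    show "fps_nth (F c) m = fps_nth (F_at c (zvar * qvar ^ r) + B c r + (\<Sum>d \<in> ?D. B d (Delta d c))) m"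
    proof (cases "m = 0")
      \<comment> \<open>The recurrence covers only m > 0. At z^0 the blocks vanish through their
        factor z, and the substitution leaves the constant coefficient unchanged.\<close>
      case True
      then show ?thesis by (simp add: fps_sum_nth B_def zvar_def F_at_shift_nth[unfolded zvar_def])
    next
      case False
      have "fps_nth (fps_nth (fps_nth (F c) m) s) n =
        fps_nth (fps_nth (fps_nth (F_at c (zvar * qvar ^ r) + B c r + (\<Sum>d \<in> ?D. B d (Delta d c))) m) s) n"
        for s n
      proof -
        have "fps_nth (fps_nth (fps_nth (F_at c (zvar * qvar ^ r)) m) s) n =
            of_nat (if n < r * m then 0 else num_cyl c m s (n - r * m))"
          by (simp add: F_at_shift_nth fps_X_power_mult_right_nth F_nth)
        moreover have "fps_nth (fps_nth (fps_nth (B d k) m) s) n =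
            of_nat (if s = 0 \<or> n < k * m then 0 else \<Sum>j<m. num_cyl d j (s - 1) (n - k * m))" for d k
          unfolding B_def block_nth by (rule block_nth_nth)
        ultimately show ?thesis
          using num_cyl_recurrence[OF _ assms(1,3), of m s n] False
          by (simp only: F_nth fps_add_nth fps_sum_nth of_nat_add of_nat_sum neq0_conv)
      qed
      then show ?thesis by (intro fps_ext)
    qed
  qed
  then show ?thesis unfolding first by (simp only: B_def sum_distrib_left)
qed

end
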